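(* Let $d\ge2$ and $f(r)=r^{-s}$ where $s>d/2$. Let $K\subset\{2,3,4,\dots\}$ and let $A_K=\{a_k\}_{k\in K}$ be a family of nonzero real numbers such that the series $$\mathsf{L}(A_K,2s):=\sum_{k\in K}\frac{a_k}{k^{2s}}$$ is absolutely convergent. Let $E_f^\kappa[L]:=E_f[L]-\sum_{k\in K}a_kE_f[kL]$. Then: 1. If $\mathsf{L}(A_K,2s)<1$, then $L_0$ is a minimizer of $L\mapsto\zeta_L(2s)$ in $\mathcal{L}_d(1)$ if and only if $L_0$ is a minimizer of $E_f^\kappa$ in $\mathcal{L}_d(1)$. 2. If $\mathsf{L}(A_K,2s)>1$, then $L_0$ is a minimizer of $L\mapsto\zeta_L(2s)$ in $\mathcal{L}_d(1)$ if and only if $L_0$ is a maximizer of $E_f^\kappa$ in $\mathcal{L}_d(1)$. In particular, for any $K\subset\{2,3,4,\dots\}$, if $a_k=1$ for all $k\in K$, then $L\mapsto\zeta_L(2s)$ and $E_f^\kappa$ have the same minimizers in $\mathcal{L}_d(1)$.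
   Context: A lattice in $\mathbb{R}^d$ is a set $L=\bigoplus_{i=1}^d\mathbb{Z}u_i$ with $\{u_1,\dots,u_d\}$ a basis of $\mathbb{R}^d$; $\mathcal{L}_d(V)$ is the set of lattices with $|\det(u_1,\dots,u_d)|=V$. $E_f[L]:=\sum_{p\in L\setminus\{0\}}f(|p|^2)$, and $\zeta_L(\sigma):=\sum_{p\in L\setminus\{0\}}|p|^{-\sigma}$ for $\sigma>d$ is the Epstein zeta function. *)

theory Defs
  imports "HOL-Analysis.Analysis"
begin

text \<open>
  The dimension \<open>d\<close> is \<open>CARD('n)\<close>, and a family \<open>u\<^sub>1, \<dots>, u\<^sub>d\<close> of vectors is a function
  \<open>u :: 'n \<Rightarrow> real^'n\<close>. Injectivity is required because \<open>independent\<close> and \<open>span\<close> only see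
  the range of the family.
\<close>

definition basis_family :: "('n::finite \<Rightarrow> real^'n) \<Rightarrow> bool" where
  "basis_family u \<longleftrightarrow> inj u \<and> independent (range u) \<and> span (range u) = UNIV"

definition lattice_gen :: "('n::finite \<Rightarrow> real^'n) \<Rightarrow> (real^'n) set" where
  "lattice_gen u = range (\<lambda>c :: 'n \<Rightarrow> int. \<Sum>i\<in>UNIV. of_int (c i) *\<^sub>R u i)"

definition lattices :: "real \<Rightarrow> (real^'n::finite) set set" where
  "lattices V = {lattice_gen u | u. basis_family u \<and> \<bar>det (\<chi> i. u i)\<bar> = V}"

definition lattice_energy :: "(real \<Rightarrow> real) \<Rightarrow> (real^'n::finite) set \<Rightarrow> real" where
  "lattice_energy f L = (\<Sum>\<^sub>\<infinity>p\<in>L - {0}. f ((norm p)\<^sup>2))"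

definition epstein_zeta :: "(real^'n::finite) set \<Rightarrow> real \<Rightarrow> real" where
  "epstein_zeta L \<sigma> = (\<Sum>\<^sub>\<infinity>p\<in>L - {0}. norm p powr (-\<sigma>))"

definition dirichlet_L :: "nat set \<Rightarrow> (nat \<Rightarrow> real) \<Rightarrow> real \<Rightarrow> real" where
  "dirichlet_L K a \<sigma> = (\<Sum>\<^sub>\<infinity>k\<in>K. a k / real k powr \<sigma>)"

definition lattice_energy_kappa ::
  "(real \<Rightarrow> real) \<Rightarrow> nat set \<Rightarrow> (nat \<Rightarrow> real) \<Rightarrow> (real^'n::finite) set \<Rightarrow> real" where
  "lattice_energy_kappa f K a L =
     lattice_energy f L - (\<Sum>\<^sub>\<infinity>k\<in>K. a k * lattice_energy f ((\<lambda>p. real k *\<^sub>R p) ` L))"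

end

theory Submission
  imports Defs
begin

text \<open>
  The power law is homogeneous, so \<open>E\<^sub>f[kL] = k\<^sup>-\<^sup>2\<^sup>s E\<^sub>f[L]\<close>, and hence
  \<open>E\<^sub>f\<^sup>\<kappa>[L] = (1 - \<L>(A\<^sub>K, 2s)) \<zeta>\<^sub>L(2s)\<close>: the two functionals differ by a constant
  factor whose sign decides between minimizers and maximizers. For \<open>a\<^sub>k = 1\<close> the factor is positive,
  since \<open>k\<^sup>-\<^sup>2\<^sup>s \<le> k\<^sup>-\<^sup>2 < 1/(k - 1/2) - 1/(k + 1/2)\<close> telescopes to at most \<open>2/3\<close>.
\<close>

lemma is_arg_min_pos_mult_iff:
  fixes g :: "'a \<Rightarrow> real"
  assumes "c > 0"
  shows "is_arg_min (\<lambda>x. c * g x) P x \<longleftrightarrow> is_arg_min g P x"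
  using assms by (simp add: is_arg_min_def)

text \<open>Both notions say that no admissible point is strictly better, and a negative factor
  reverses strict inequalities.\<close>

lemma is_arg_max_neg_mult_iff:
  fixes g :: "'a \<Rightarrow> real"
  assumes "c < 0"
  shows "is_arg_max (\<lambda>x. c * g x) P x \<longleftrightarrow> is_arg_min g P x"
  using assms by (simp add: is_arg_max_def is_arg_min_def)

lemma epstein_zeta_scale:
  fixes L :: "(real^'n::finite) set"
  assumes "c > 0"
  shows "epstein_zeta ((\<lambda>p. c *\<^sub>R p) ` L) \<sigma> = epstein_zeta L \<sigma> / c powr \<sigma>"
proof -
  have "(\<lambda>p. c *\<^sub>R p) ` L - {0} = (\<lambda>p. c *\<^sub>R p) ` (L - {0})"
    using assms by auto
  moreover have "inj_on (\<lambda>p. c *\<^sub>R p) (L - {0})"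
    using assms by (auto simp: inj_on_def)
  ultimately have "epstein_zeta ((\<lambda>p. c *\<^sub>R p) ` L) \<sigma>
      = (\<Sum>\<^sub>\<infinity>p\<in>L - {0}. norm (c *\<^sub>R p) powr (-\<sigma>))"
    by (simp add: epstein_zeta_def infsum_reindex o_def)
  also have "\<dots> = (\<Sum>\<^sub>\<infinity>p\<in>L - {0}. c powr (-\<sigma>) * norm p powr (-\<sigma>))"
    using assms by (simp add: powr_mult)
  \<comment> \<open>The nonzero factor preserves divergence as well; in that case both sides take
    the default value 0.\<close>
  also have "\<dots> = c powr (-\<sigma>) * epstein_zeta L \<sigma>"
    by (simp add: infsum_cmult_right' epstein_zeta_def)
  finally show ?thesis
    by (simp add: powr_minus divide_inverse)
qed

lemma lattice_energy_power_law:
  fixes L :: "(real^'n::finite) set"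
  assumes "\<And>r. r > 0 \<Longrightarrow> f r = r powr (-s)"
  shows "lattice_energy f L = epstein_zeta L (2 * s)"
  unfolding lattice_energy_def epstein_zeta_def
proof (rule infsum_cong)
  fix p :: "real^'n"
  assume "p \<in> L - {0}"
  \<comment> \<open>\<open>f\<close> is prescribed only at positive arguments, so the exclusion of
    the origin matters here.\<close>
  then have "norm p > 0" by simp
  then show "f ((norm p)\<^sup>2) = norm p powr (- (2 * s))"
    using assms powr_powr[of "norm p" 2 "-s"] by simp
qed

lemma lattice_energy_kappa_power_law:
  fixes L :: "(real^'n::finite) set"
  assumes "\<And>r. r > 0 \<Longrightarrow> f r = r powr (-s)" and "K \<subseteq> {1..}"
  shows "lattice_energy_kappa f K a L = (1 - dirichlet_L K a (2 * s)) * epstein_zeta L (2 * s)"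
proof -
  note energy = lattice_energy_power_law[where f = f and s = s, OF assms(1)]
  have "(\<Sum>\<^sub>\<infinity>k\<in>K. a k * lattice_energy f ((\<lambda>p. real k *\<^sub>R p) ` L))
      = (\<Sum>\<^sub>\<infinity>k\<in>K. a k / real k powr (2 * s) * epstein_zeta L (2 * s))"
  proof (rule infsum_cong)
    fix k assume "k \<in> K"
    \<comment> \<open>Excluding k = 0 keeps the scaling injective.\<close>
    then have "real k > 0" using assms(2) by auto
    then show "a k * lattice_energy f ((\<lambda>p. real k *\<^sub>R p) ` L)
        = a k / real k powr (2 * s) * epstein_zeta L (2 * s)"
      by (simp add: energy epstein_zeta_scale)
  qed
  also have "\<dots> = dirichlet_L K a (2 * s) * epstein_zeta L (2 * s)"
    unfolding dirichlet_L_def by (rule infsum_cmult_left')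
  finally show ?thesis
    by (simp add: lattice_energy_kappa_def energy algebra_simps)
qed

text \<open>The subtracted fraction is the end term of the telescoping sum; keeping it lets the
  induction close.\<close>

lemma sum_inverse_squares_le:
  "(\<Sum>k = 2..<n + 2. 1 / real k ^ 2) \<le> 2 / 3 - 1 / (real n + 3 / 2)"
proof (induction n)
  case (Suc n)
  \<comment> \<open>With k = n + 2, the right side is 1/(k - 1/2) - 1/(k + 1/2) = 1/(k^2 -
    1/4).\<close>
  have "1 / real (n + 2) ^ 2 \<le> 1 / (real n + 3 / 2) - 1 / (real (Suc n) + 3 / 2)"
    by (simp add: divide_simps power2_eq_square) (simp add: algebra_simps)
  with Suc show ?case by simp
qed simp

lemma dirichlet_L_one_less_one:
  assumes "K \<subseteq> {2..}" and "\<forall>k\<in>K. a k = 1" and "\<sigma> \<ge> 2"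
  shows "dirichlet_L K a \<sigma> < 1"
proof (cases "(\<lambda>k. a k / real k powr \<sigma>) summable_on K")
  case True
  \<comment> \<open>A strict bound on the finite sums could become an equality in the limit, hence a
    uniform constant below 1.\<close>
  then have "dirichlet_L K a \<sigma> \<le> 2 / 3"
    unfolding dirichlet_L_def
  proof (rule infsum_le_finite_sums)
    fix F assume F: "finite F" "F \<subseteq> K"
    then obtain n where "\<forall>k\<in>F. k < n"
      using finite_nat_set_iff_bounded by blast
    with F assms have sub: "F \<subseteq> {2..<n + 2}" by force
    have "(\<Sum>k\<in>F. a k / real k powr \<sigma>) \<le> (\<Sum>k\<in>F. 1 / real k ^ 2)"
    proof (rule sum_mono)
      fix k assume "k \<in> F"
      then have "k \<ge> 2" "a k = 1" using F assms by auto
      moreover from this have "real k ^ 2 \<le> real k powr \<sigma>"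
        using powr_mono[of 2 \<sigma> "real k"] assms(3) by (simp add: powr_numeral)
      ultimately show "a k / real k powr \<sigma> \<le> 1 / real k ^ 2"
        by (auto intro!: divide_left_mono)
    qed
    also have "\<dots> \<le> (\<Sum>k = 2..<n + 2. 1 / real k ^ 2)"
      using sub by (intro sum_mono2) auto
    also have "\<dots> \<le> 2 / 3"
      by (rule order_trans[OF sum_inverse_squares_le]) simp
    finally show "(\<Sum>k\<in>F. a k / real k powr \<sigma>) \<le> 2 / 3" .
  qed
  then show ?thesis by simp
next
  \<comment> \<open>This case cannot arise for such exponents, but the default value 0 settles it
    without a convergence proof.\<close>
  case False
  then show ?thesis by (simp add: dirichlet_L_def infsum_not_exists)
qed

theorem theorem2p15:
  fixes s :: real and f :: "real \<Rightarrow> real"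
  assumes "CARD('n::finite) \<ge> 2"
    and "s > real CARD('n) / 2"
    and "\<And>r. r > 0 \<Longrightarrow> f r = r powr (-s)"
  shows
    "(\<forall>(K :: nat set) (a :: nat \<Rightarrow> real).
        K \<subseteq> {2..} \<longrightarrow> (\<forall>k\<in>K. a k \<noteq> 0) \<longrightarrow>
        (\<lambda>k. \<bar>a k / real k powr (2 * s)\<bar>) summable_on K \<longrightarrow>
          (dirichlet_L K a (2 * s) < 1 \<longrightarrow>
             (\<forall>L0 :: (real^'n) set.
                is_arg_min (\<lambda>L. epstein_zeta L (2 * s)) (\<lambda>L. L \<in> lattices 1) L0 \<longleftrightarrow>
                is_arg_min (lattice_energy_kappa f K a) (\<lambda>L. L \<in> lattices 1) L0)) \<and>
          (dirichlet_L K a (2 * s) > 1 \<longrightarrow>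
             (\<forall>L0 :: (real^'n) set.
                is_arg_min (\<lambda>L. epstein_zeta L (2 * s)) (\<lambda>L. L \<in> lattices 1) L0 \<longleftrightarrow>
                is_arg_max (lattice_energy_kappa f K a) (\<lambda>L. L \<in> lattices 1) L0)))
     \<and>
     (\<forall>(K :: nat set) (a :: nat \<Rightarrow> real).
        K \<subseteq> {2..} \<longrightarrow> (\<forall>k\<in>K. a k = 1) \<longrightarrow>
          (\<forall>L0 :: (real^'n) set.
             is_arg_min (\<lambda>L. epstein_zeta L (2 * s)) (\<lambda>L. L \<in> lattices 1) L0 \<longleftrightarrow>
             is_arg_min (lattice_energy_kappa f K a) (\<lambda>L. L \<in> lattices 1) L0))"
proof -
  have kappa: "lattice_energy_kappa f K a
      = (\<lambda>L :: (real^'n) set. (1 - dirichlet_L K a (2 * s)) * epstein_zeta L (2 * s))"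
    if "K \<subseteq> {2..}" for K a
    using that by (intro ext lattice_energy_kappa_power_law assms(3)) auto
  \<comment> \<open>The exponent condition holds because 2s > d \<ge> 2.\<close>
  have less_one: "dirichlet_L K a (2 * s) < 1" if "K \<subseteq> {2..}" "\<forall>k\<in>K. a k = 1" for K a
    using that assms(1,2) by (intro dirichlet_L_one_less_one) auto
  show ?thesis
    by (simp add: kappa less_one is_arg_min_pos_mult_iff is_arg_max_neg_mult_iff)
qed

end
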